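(* $D(K_3\,\Box\,K_3,2)=2$.
   Context: Graphs are finite and simple. For a graph $G$ and a positive integer $k$, a (fractional) $k$-coloring of $G$ is an assignment to every vertex $v$ of real numbers $f_1(v),\dots,f_k(v)\ge 0$ with $\sum_{j=1}^k f_j(v)=1$ ($f_j(v)$ is the usage of color $j$ at $v$). The defect of $v$ is $\mathrm{df}(v)=\sum_{w\in N(v)}\sum_{j=1}^k\min(f_j(v),f_j(w))$, where $N(v)$ is the set of neighbors of $v$. The defect of the coloring is $\max_v \mathrm{df}(v)$, and the minimum defect $D(G,k)$ is the minimum of this quantity over all $k$-colorings of $G$. $G\,\Box\,H$ denotes the Cartesian product: its vertex set is $V(G)\times V(H)$, and $(u_1,u_2)$, $(v_1,v_2)$ are adjacent if $u_1v_1\in E(G)$ and $u_2=v_2$, or $u_1=v_1$ and $u_2v_2\in E(H)$. $K_3$ is the complete graph on $3$ vertices. *)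

theory Defs
  imports "HOL-Analysis.Analysis" "Graph_Theory.Kuratowski"
begin

text \<open>A finite simple graph is a \<^locale>\<open>pair_graph\<close>: every edge is a pair of opposite arcs.\<close>

definition cartesian_product ::
    "'a pair_pre_digraph \<Rightarrow> 'b pair_pre_digraph \<Rightarrow> ('a \<times> 'b) pair_pre_digraph"
    (infixr \<open>\<box>\<close> 75) where
  "G \<box> H = \<lparr> pverts = pverts G \<times> pverts H,
     parcs = {((u1, u2), (v1, v2)).
       (u1, u2) \<in> pverts G \<times> pverts H \<and> (v1, v2) \<in> pverts G \<times> pverts H \<and>
       ((u1, v1) \<in> parcs G \<and> u2 = v2 \<or> u1 = v1 \<and> (u2, v2) \<in> parcs H)} \<rparr>"

definition coloring :: "'a pair_pre_digraph \<Rightarrow> nat \<Rightarrow> ('a \<Rightarrow> nat \<Rightarrow> real) \<Rightarrow> bool" where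
  "coloring G k f \<longleftrightarrow>
     (\<forall>v\<in>pverts G. (\<forall>j\<in>{1..k}. f v j \<ge> 0) \<and> (\<Sum>j=1..k. f v j) = 1)"

definition nbhd :: "'a pair_pre_digraph \<Rightarrow> 'a \<Rightarrow> 'a set" where
  "nbhd G v = {w. (v, w) \<in> parcs G}"

definition df :: "'a pair_pre_digraph \<Rightarrow> nat \<Rightarrow> ('a \<Rightarrow> nat \<Rightarrow> real) \<Rightarrow> 'a \<Rightarrow> real" where
  "df G k f v = (\<Sum>w\<in>nbhd G v. \<Sum>j=1..k. min (f v j) (f w j))"

definition defect :: "'a pair_pre_digraph \<Rightarrow> nat \<Rightarrow> ('a \<Rightarrow> nat \<Rightarrow> real) \<Rightarrow> real" where
  "defect G k f = Max (df G k f ` pverts G)"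

text \<open>A genuine minimum, not an infimum; \<open>minimum_defect_attained\<close> below shows that it
  exists for every nonempty graph and every positive number of colors.\<close>

definition minimum_defect :: "'a pair_pre_digraph \<Rightarrow> nat \<Rightarrow> real" where
  "minimum_defect G k = (LEAST d. \<exists>f. coloring G k f \<and> d = defect G k f)"

lemma pair_graph_cartesian_product:
  assumes "pair_graph G" "pair_graph H"
  shows "pair_graph (G \<box> H)"
proof -
  interpret G: pair_graph G by fact
  interpret H: pair_graph H by fact
  have "finite (pverts (G \<box> H))"
    by (simp add: cartesian_product_def G.pair_finite_verts H.pair_finite_verts)
  moreover have sub: "parcs (G \<box> H) \<subseteq> pverts (G \<box> H) \<times> pverts (G \<box> H)"
    by (auto simp: cartesian_product_def)
  ultimately have fin: "finite (pverts (G \<box> H))" "finite (parcs (G \<box> H))"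
    by (auto intro: finite_subset)
  have symG: "(u, v) \<in> parcs G \<Longrightarrow> (v, u) \<in> parcs G" for u v
    using G.pair_sym_arcs by (auto simp: symmetric_def sym_def)
  have symH: "(u, v) \<in> parcs H \<Longrightarrow> (v, u) \<in> parcs H" for u v
    using H.pair_sym_arcs by (auto simp: symmetric_def sym_def)
  show ?thesis
  proof
    show "e \<in> parcs (G \<box> H) \<Longrightarrow> fst e \<in> pverts (G \<box> H)" for e using sub by auto
    show "e \<in> parcs (G \<box> H) \<Longrightarrow> snd e \<in> pverts (G \<box> H)" for e using sub by auto
    show "e \<in> parcs (G \<box> H) \<Longrightarrow> fst e \<noteq> snd e" for e
      using G.pair_no_loops H.pair_no_loops by (fastforce simp: cartesian_product_def)
    show "symmetric (with_proj (G \<box> H))"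
      by (auto simp: symmetric_def sym_def cartesian_product_def intro: symG symH)
  qed (use fin in auto)
qed

lemma complete_digraph_exists:
  "K\<^bsub>n\<^esub> (with_proj \<lparr> pverts = {..<n}, parcs = {(u, v). u < n \<and> v < n \<and> u \<noteq> v} \<rparr>)"
  by (auto simp: complete_digraph_pair_def)

lemma compact_PiE_UNIV:
  fixes S :: "'i \<Rightarrow> 'b::topological_space set"
  assumes "\<And>i. compact (S i)"
  shows "compact (PiE UNIV S)"
proof -
  have "compactin (product_topology (\<lambda>i. euclidean) UNIV) (PiE UNIV S)"
    using assms by (simp add: compactin_PiE)
  then show ?thesis
    by (simp add: euclidean_product_topology)
qed

lemma minimum_defect_attained:
  assumes "pair_graph G" and ne: "pverts G \<noteq> {}" and k: "k \<ge> 1"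
  shows "\<exists>f. coloring G k f \<and> defect G k f = minimum_defect G k \<and>
           (\<forall>g. coloring G k g \<longrightarrow> minimum_defect G k \<le> defect G k g)"
proof -
  interpret pair_graph G by fact
  define V where "V = pverts G"
  have finV: "finite V" using pair_finite_verts by (simp add: V_def)
  have neV: "V \<noteq> {}" using ne by (simp add: V_def)
  define S where "S v j = (if v \<in> V \<and> j \<in> {1..k} then {0..1::real} else {0})" for v and j :: nat
  define B where "B = {f. \<forall>v j. f v j \<in> S v j}"
  define C where "C = B \<inter> {f. \<forall>v\<in>V. (\<Sum>j=1..k. f v j) = 1}"
  have c1: "compact (PiE UNIV (S v))" for v
    by (rule compact_PiE_UNIV) (auto simp: S_def)
  have "compact (PiE UNIV (\<lambda>v. PiE UNIV (S v)))"
    by (rule compact_PiE_UNIV) (rule c1)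
  moreover have "PiE UNIV (\<lambda>v. PiE UNIV (S v)) = B"
    by (auto simp: B_def PiE_def Pi_def)
  ultimately have "compact B" by simp
  have ev: "continuous_on UNIV (\<lambda>f :: 'a \<Rightarrow> nat \<Rightarrow> real. f v j)" for v j
    by (rule continuous_on_subset[OF continuous_on_product_then_coordinatewise
          [OF continuous_on_product_coordinates]]) simp
  have "closed {f :: 'a \<Rightarrow> nat \<Rightarrow> real. \<forall>v\<in>V. (\<Sum>j=1..k. f v j) = 1}"
    unfolding Collect_ball_eq
    by (intro closed_INT ballI closed_Collect_eq continuous_on_sum continuous_on_const ev)
  with \<open>compact B\<close> have "compact C"
    unfolding C_def by (intro compact_Int_closed)
  have "(\<lambda>v j. if v \<in> V \<and> j = 1 then 1 else 0) \<in> C"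
    using k by (auto simp: C_def B_def S_def sum.delta)
  then have "C \<noteq> {}" by blast
  have cdf: "continuous_on C (\<lambda>f. df G k f v)" for v
    unfolding df_def
    by (intro continuous_on_sum continuous_on_min continuous_on_subset[OF ev]) auto
  have "continuous_on C (\<lambda>f. Max ((\<lambda>v. df G k f v) ` A))" if "finite A" "A \<noteq> {}" for A
    using that
  proof (induction rule: finite_ne_induct)
    case (singleton v) then show ?case using cdf by simp
  next
    case (insert v A)
    have "(\<lambda>f. Max ((\<lambda>v. df G k f v) ` insert v A))
        = (\<lambda>f. max (df G k f v) (Max ((\<lambda>v. df G k f v) ` A)))"
      using insert by simp
    then show ?case using insert cdf by (auto intro: continuous_on_max)
  qed
  from this[OF finV neV] have cdef: "continuous_on C (defect G k)"
    by (simp add: defect_def[abs_def] V_def)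
  obtain f where f: "f \<in> C" "\<And>g. g \<in> C \<Longrightarrow> defect G k f \<le> defect G k g"
    using continuous_attains_inf[OF \<open>compact C\<close> \<open>C \<noteq> {}\<close> cdef] by blast
  have colf: "coloring G k f"
    using f(1) by (force simp: C_def B_def S_def coloring_def V_def split: if_splits)
  have min: "defect G k f \<le> defect G k g" if g: "coloring G k g" for g
  proof -
    define h where "h v j = (if v \<in> V \<and> j \<in> {1..k} then g v j else 0)" for v j
    have le1: "g v j \<le> 1" if "v \<in> V" "j \<in> {1..k}" for v j
    proof -
      have "g v j \<le> (\<Sum>j=1..k. g v j)"
        using g that by (intro member_le_sum) (auto simp: coloring_def V_def)
      then show ?thesis using g that by (auto simp: coloring_def V_def)
    qed
    have "h \<in> C"
      using g le1 by (auto simp: C_def B_def S_def h_def coloring_def V_def)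
    have "df G k h v = df G k g v" if "v \<in> V" for v
      unfolding df_def using that
      by (intro sum.cong refl) (auto simp: h_def nbhd_def V_def dest: in_arcsD2)
    then have "defect G k h = defect G k g"
      by (auto simp: defect_def V_def intro!: arg_cong[where f = Max] image_cong)
    with f(2)[OF \<open>h \<in> C\<close>] show ?thesis by simp
  qed
  have "minimum_defect G k = defect G k f"
    unfolding minimum_defect_def by (rule Least_equality) (use colf min in auto)
  with colf min show ?thesis by auto
qed

end

theory Submission
  imports Defs
begin

text \<open>
  Two colors leave one real number per vertex, \<open>x v = f v 1\<close> in the unit interval, and since
  \<open>min s t + min (1 - s) (1 - t) = 1 - \<bar>s - t\<bar>\<close>, the defect of a vertex of the 4-regular graph
  \<open>K\<^sub>3 \<box> K\<^sub>3\<close> is \<open>4\<close> minus its contrast, the sum of \<open>\<bar>x v - x w\<bar>\<close> over its neighbors \<open>w\<close>.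
  The vertices form a \<open>3 \<times> 3\<close> grid in which two cells are adjacent when they share a row or a
  column. Giving one color to a diagonal and the other color to the remaining cells makes every
  contrast at least \<open>2\<close>. It remains to see that the contrasts cannot all exceed \<open>2\<close>.

  Suppose that they do. Call a cell low if its value is at most \<open>1/2\<close>. A low cell \<open>v\<close> cannot
  have two neighbors with values at most \<open>x v\<close>: these two contribute at most \<open>2 x v\<close>, the other
  two at most \<open>2 (1 - x v)\<close>. Hence low cells contain no cycle of the graph, because a largest
  cell on a cycle has two such neighbors (\<open>no_low_line\<close>, \<open>no_low_rectangle\<close>,
  \<open>no_low_hexagon\<close>). Replacing \<open>x\<close> by \<open>1 - x\<close> gives the same for high cells.

  Every row is then split 2 to 1, and up to complementation two of the rows have two low cells.
  Excluding cycles leaves, up to symmetry, a single arrangement: the low cells form an induced path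
  on five cells, and one of the high cells is adjacent to both ends of this path. The
  contrasts of the three inner cells of the path force the end values to be large, while the
  contrast of that high cell forces them to be small (\<open>no_low_path\<close>).
\<close>

section \<open>Grids in which every cell has contrast above 2\<close>

text \<open>The terms with \<open>j = i\<close> or \<open>q = p\<close> vanish, so the two sums range over the neighbors of the
  cell \<open>(i, p)\<close>.\<close>

locale contrasting_grid =
  fixes A :: "'a set" and B :: "'b set" and x :: "'a \<Rightarrow> 'b \<Rightarrow> real"
  assumes card_rows: "card A = 3" and card_columns: "card B = 3"
    and range: "\<lbrakk>i \<in> A; p \<in> B\<rbrakk> \<Longrightarrow> 0 \<le> x i p \<and> x i p \<le> 1"
    and contrast: "\<lbrakk>i \<in> A; p \<in> B\<rbrakk> \<Longrightarrow>
      2 < (\<Sum>j\<in>A. \<bar>x i p - x j p\<bar>) + (\<Sum>q\<in>B. \<bar>x i p - x i q\<bar>)"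

lemma third_element:
  assumes "card S = 3" "s \<in> S" "t \<in> S" "s \<noteq> t"
  obtains u where "S = {s, t, u}"
  using assms by (auto simp: card_3_iff)

lemma distinct_if_card_3:
  assumes "card {s, t, u} = 3"
  shows "s \<noteq> t" "s \<noteq> u" "t \<noteq> u"
  using assms by (auto simp: card_insert_if split: if_splits)

text \<open>The two neighbors below \<open>v\<close> contribute at most \<open>2 v\<close>. As \<open>v \<le> 1 - v\<close>, any other neighbor
  contributes at most \<open>1 - v\<close>.\<close>

lemma contrast_le_2_if_two_lower:
  fixes v :: real
  assumes "0 \<le> w1" "w1 \<le> v" "0 \<le> w2" "w2 \<le> v" "v \<le> 1/2"
    and "0 \<le> w3" "w3 \<le> 1" "0 \<le> w4" "w4 \<le> 1"
  shows "\<bar>v - w1\<bar> + \<bar>v - w2\<bar> + \<bar>v - w3\<bar> + \<bar>v - w4\<bar> \<le> 2"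
  using assms by linarith

context contrasting_grid
begin

lemma transpose: "contrasting_grid B A (\<lambda>p i. x i p)"
  using card_rows card_columns range contrast
  by unfold_locales (auto simp: add.commute)

lemma complement: "contrasting_grid A B (\<lambda>i p. 1 - x i p)"
  using card_rows card_columns range contrast
  by unfold_locales (auto simp: abs_minus_commute)

lemma contrast_expand:
  assumes "A = {a, b, c}" "B = {p, q, r}"
  shows "2 < \<bar>x a p - x b p\<bar> + \<bar>x a p - x c p\<bar> + \<bar>x a p - x a q\<bar> + \<bar>x a p - x a r\<bar>"
proof -
  note distinct = distinct_if_card_3[OF card_rows[unfolded assms(1)]]
    distinct_if_card_3[OF card_columns[unfolded assms(2)]]
  have "2 < (\<Sum>j\<in>{a, b, c}. \<bar>x a p - x j p\<bar>) + (\<Sum>s\<in>{p, q, r}. \<bar>x a p - x a s\<bar>)"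
    using contrast[of a p] unfolding assms by simp
  with distinct show ?thesis by simp
qed

lemma higher_neighbor_in_column:
  assumes "A = {a, b, c}" "p \<in> B" and low: "x a p \<le> 1/2"
  shows "x a p < x b p \<or> x a p < x c p"
proof (rule ccontr)
  assume *: "\<not> ?thesis"
  obtain q r where B: "B = {p, q, r}"
    using card_columns \<open>p \<in> B\<close> by (auto simp: card_3_iff)
  show False
    using contrast_expand[OF assms(1) B] * low range[of a p] range[of b p] range[of c p]
      range[of a q] range[of a r] assms(1) B
      contrast_le_2_if_two_lower[of "x b p" "x a p" "x c p" "x a q" "x a r"]
    by simp
qed

lemma higher_neighbor_at_corner:
  assumes "a \<in> A" "b \<in> A" "a \<noteq> b" "p \<in> B" "q \<in> B" "p \<noteq> q" and low: "x a p \<le> 1/2"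
  shows "x a p < x b p \<or> x a p < x a q"
proof (rule ccontr)
  assume *: "\<not> ?thesis"
  obtain c where A: "A = {a, b, c}"
    by (rule third_element[OF card_rows assms(1,2,3)])
  obtain r where B: "B = {p, q, r}"
    by (rule third_element[OF card_columns assms(4,5,6)])
  show False
    using contrast_expand[OF A B] * low range[of a p] range[of b p] range[of c p]
      range[of a q] range[of a r] A B
      contrast_le_2_if_two_lower[of "x b p" "x a p" "x a q" "x c p" "x a r"]
    by simp
qed

section \<open>Low cells contain no cycle\<close>

text \<open>For a line, a rectangle and a hexagon alike, a largest cell of the cycle would have both of its
  neighbors on the cycle at or below itself.\<close>

lemma no_low_column:
  assumes "p \<in> B"
  shows "\<exists>i\<in>A. 1/2 < x i p"
proof -
  obtain a b c where A: "A = {a, b, c}"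
    using card_rows by (auto simp: card_3_iff)
  then have "A = {b, a, c}" "A = {c, a, b}" by auto
  with A show ?thesis
    using higher_neighbor_in_column[OF A assms]
      higher_neighbor_in_column[OF \<open>A = {b, a, c}\<close> assms]
      higher_neighbor_in_column[OF \<open>A = {c, a, b}\<close> assms]
    by (force simp: not_less)
qed

lemma no_low_line:
  shows "p \<in> B \<Longrightarrow> \<exists>i\<in>A. 1/2 < x i p" and "i \<in> A \<Longrightarrow> \<exists>p\<in>B. 1/2 < x i p"
  by (fact no_low_column) (fact contrasting_grid.no_low_column[OF transpose])

lemma no_low_rectangle:
  assumes "a \<in> A" "b \<in> A" "a \<noteq> b" "p \<in> B" "q \<in> B" "p \<noteq> q"
    and low: "x a p \<le> 1/2" "x a q \<le> 1/2" "x b p \<le> 1/2" "x b q \<le> 1/2"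
  shows False
proof -
  have "x a p < x b p \<or> x a p < x a q" "x a q < x b q \<or> x a q < x a p"
    "x b p < x a p \<or> x b p < x b q" "x b q < x a q \<or> x b q < x b p"
    using assms by (intro higher_neighbor_at_corner; simp)+
  then show False by linarith
qed

lemma no_low_hexagon:
  assumes A: "A = {a, b, c}" and B: "B = {p, q, r}"
    and low: "x a q \<le> 1/2" "x a r \<le> 1/2" "x b r \<le> 1/2" "x b p \<le> 1/2" "x c p \<le> 1/2" "x c q \<le> 1/2"
  shows False
proof -
  note distinct = distinct_if_card_3[OF card_rows[unfolded A]]
    distinct_if_card_3[OF card_columns[unfolded B]]
  have "x a q < x c q \<or> x a q < x a r" "x a r < x b r \<or> x a r < x a q"
    "x b r < x a r \<or> x b r < x b p" "x b p < x c p \<or> x b p < x b r"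
    "x c p < x b p \<or> x c p < x c q" "x c q < x a q \<or> x c q < x c p"
    using distinct low A B by (intro higher_neighbor_at_corner; simp)+
  then show False by argo
qed

section \<open>The remaining arrangement\<close>

text \<open>The low cells \<open>(a, q), (a, r), (b, r), (b, p), (c, p)\<close> form a path in this order. Write
  \<open>1 - g\<close> and \<open>1 - h\<close> for the values of the high cells \<open>(b, q)\<close> and \<open>(c, r)\<close>. The high cell \<open>(c, q)\<close>
  is adjacent to these two and to both ends of the path, so its contrast above \<open>2\<close> makes the sum of
  the end values smaller than \<open>g + h\<close>. On the other hand, if the middle cell \<open>(b, r)\<close> lies below
  both of its neighbors on the path, then the contrast of \<open>(a, r)\<close>, which is adjacent to \<open>(c, r)\<close>,
  forces the end \<open>(a, q)\<close> above \<open>h\<close>, and the contrast of \<open>(b, p)\<close>, which is adjacent to \<open>(b, q)\<close>,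
  forces the end \<open>(c, p)\<close> above \<open>g\<close>. Otherwise the values pass monotonically through the middle
  cell; it is adjacent to both \<open>(b, q)\<close> and \<open>(c, r)\<close>, so its next cell already exceeds \<open>g + h\<close>, and
  the values keep rising up to the end of the path.\<close>

lemma no_low_path:
  assumes A: "A = {a, b, c}" and B: "B = {p, q, r}"
    and low: "x a q \<le> 1/2" "x a r \<le> 1/2" "x b r \<le> 1/2" "x b p \<le> 1/2" "x c p \<le> 1/2"
    and high: "1/2 \<le> x a p" "1/2 \<le> x b q" "1/2 \<le> x c q" "1/2 \<le> x c r"
  shows False
proof -
  note distinct = distinct_if_card_3[OF card_rows[unfolded A]]
    distinct_if_card_3[OF card_columns[unfolded B]]
  have bounds: "0 \<le> x i s" "x i s \<le> 1" if "i \<in> {a, b, c}" "s \<in> {p, q, r}" for i s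
    using range that A B by auto
  note bounds = bounds[of a p] bounds[of a q] bounds[of a r] bounds[of b p] bounds[of b q]
    bounds[of b r] bounds[of c p] bounds[of c q] bounds[of c r]
  have ar: "2 < \<bar>x a r - x a q\<bar> + \<bar>x a r - x b r\<bar> + (x a p - x a r) + (x c r - x a r)"
    using contrast_expand[of a b c r p q] A B low high by (auto simp: insert_commute)
  have br: "2 < \<bar>x b r - x a r\<bar> + \<bar>x b r - x b p\<bar> + (x b q - x b r) + (x c r - x b r)"
    using contrast_expand[of b a c r p q] A B low high by (auto simp: insert_commute)
  have bp: "2 < \<bar>x b p - x b r\<bar> + \<bar>x b p - x c p\<bar> + (x a p - x b p) + (x b q - x b p)"
    using contrast_expand[of b a c p q r] A B low high by (auto simp: insert_commute)
  have cq: "2 < \<bar>x c q - x b q\<bar> + \<bar>x c q - x c r\<bar> + (x c q - x a q) + (x c q - x c p)"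
    using contrast_expand[of c a b q p r] A B low high by (auto simp: insert_commute)
  have rise: "x a r < x b r \<or> x a r < x a q" "x b r < x a r \<or> x b r < x b p"
    "x b p < x c p \<or> x b p < x b r"
    using distinct low A B by (intro higher_neighbor_at_corner; simp)+
  have ends_small: "x a q + x c p < (1 - x b q) + (1 - x c r)"
    using cq bounds by (auto simp: abs_real_def split: if_splits)
  have ends_large: "(1 - x b q) + (1 - x c r) < x a q + x c p"
  proof -
    consider (valley) "x b r < x a r" "x b r < x b p" | (up) "x a r \<le> x b r" | (down) "x b p \<le> x b r"
      by linarith
    then show ?thesis
    proof cases
      case valley
      with rise have "x a r < x a q" "x b p < x c p" by auto
      with valley ar bp bounds show ?thesis by auto
    next
      case up
      with rise have "x b r < x b p" by auto
      with rise have "x b p < x c p" by auto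
      with up \<open>x b r < x b p\<close> br bounds show ?thesis by auto
    next
      case down
      with rise have "x b r < x a r" by auto
      with rise have "x a r < x a q" by auto
      with down \<open>x b r < x a r\<close> br bounds show ?thesis by auto
    qed
  qed
  show False using ends_small ends_large by simp
qed

definition mostly_low :: "'a \<Rightarrow> bool" where
  "mostly_low i \<longleftrightarrow> (\<exists>p\<in>B. \<forall>q\<in>B - {p}. x i q \<le> 1/2)"

text \<open>Suppose that two rows \<open>a\<close> and \<open>b\<close> have at most one high cell each. Low cells fill neither a
  line nor a rectangle, so these high cells exist and lie in different columns, say at \<open>(a, p)\<close> and
  \<open>(b, q)\<close>. Let \<open>c\<close> and \<open>r\<close> be the remaining row and column. The cells \<open>(a, r)\<close> and \<open>(b, r)\<close> force
  \<open>(c, r)\<close> to be high, and as row \<open>c\<close> is not all high, \<open>(c, p)\<close> or \<open>(c, q)\<close> is low. If both are low,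
  there is a hexagon of low cells; if only one is low, there is the path excluded above, possibly
  after swapping \<open>a\<close> with \<open>b\<close> and \<open>p\<close> with \<open>q\<close>.\<close>

lemma mostly_low_row_unique:
  assumes a: "a \<in> A" "mostly_low a" and b: "b \<in> A" "mostly_low b"
  shows "a = b"
proof (rule ccontr)
  assume "a \<noteq> b"
  obtain c where A: "A = {a, b, c}"
    by (rule third_element[OF card_rows a(1) b(1) \<open>a \<noteq> b\<close>])
  obtain p where p: "p \<in> B" "\<And>s. \<lbrakk>s \<in> B; s \<noteq> p\<rbrakk> \<Longrightarrow> x a s \<le> 1/2"
    using a(2) by (auto simp: mostly_low_def)
  obtain q where q: "q \<in> B" "\<And>s. \<lbrakk>s \<in> B; s \<noteq> q\<rbrakk> \<Longrightarrow> x b s \<le> 1/2"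
    using b(2) by (auto simp: mostly_low_def)
  have "p \<noteq> q"
  proof
    assume "p = q"
    obtain s t where st: "B = {p, s, t}" using card_columns p(1) by (auto simp: card_3_iff)
    note distinct = distinct_if_card_3[OF card_columns[unfolded st]]
    have "s \<in> B" "t \<in> B" using st by auto
    with distinct show False
      using no_low_rectangle[of a b s t] a(1) b(1) \<open>a \<noteq> b\<close> p(2) q(2) \<open>p = q\<close> by metis
  qed
  obtain r where B: "B = {p, q, r}"
    by (rule third_element[OF card_columns p(1) q(1) \<open>p \<noteq> q\<close>])
  note distinct = distinct_if_card_3[OF card_rows[unfolded A]]
    distinct_if_card_3[OF card_columns[unfolded B]]
  have low: "x a q \<le> 1/2" "x a r \<le> 1/2" "x b p \<le> 1/2" "x b r \<le> 1/2"
    using p(2) q(2) B distinct by auto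
  have high: "1/2 < x a p" "1/2 < x b q"
    using no_low_line(2)[of a] no_low_line(2)[of b] low A B by (auto simp: not_less)
  have cr: "1/2 < x c r"
    using no_low_line(1)[of r] low A B by auto
  interpret comp: contrasting_grid A B "\<lambda>i p. 1 - x i p" by (rule complement)
  have "x c p < 1/2 \<or> x c q < 1/2"
    using comp.no_low_line(2)[of c] cr A B by auto
  then consider "x c p \<le> 1/2" "x c q \<le> 1/2" | "x c p \<le> 1/2" "1/2 \<le> x c q"
    | "1/2 \<le> x c p" "x c q \<le> 1/2" by linarith
  then show False
  proof cases
    case 1
    then show False using no_low_hexagon[OF A B] low by simp
  next
    case 2
    then show False using no_low_path[OF A B] low high cr by simp
  next
    case 3
    have "A = {b, a, c}" "B = {q, p, r}" using A B by auto
    from no_low_path[OF this] 3 show False using low high cr by simp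
  qed
qed

end

lemma no_contrasting_grid: "\<not> contrasting_grid A B x"
proof
  assume "contrasting_grid A B x"
  then interpret contrasting_grid A B x .
  interpret comp: contrasting_grid A B "\<lambda>i p. 1 - x i p" by (rule complement)
  obtain p q r where B: "B = {p, q, r}" "p \<noteq> q" "p \<noteq> r" "q \<noteq> r"
    using card_columns by (auto simp: card_3_iff)
  have split: "mostly_low i \<or> comp.mostly_low i" for i
  proof -
    have "mostly_low i \<longleftrightarrow> (x i q \<le> 1/2 \<and> x i r \<le> 1/2) \<or> (x i p \<le> 1/2 \<and> x i r \<le> 1/2)
        \<or> (x i p \<le> 1/2 \<and> x i q \<le> 1/2)"
      unfolding mostly_low_def using B by (auto simp: insert_Diff_if)
    moreover have "comp.mostly_low i \<longleftrightarrow> (x i q \<ge> 1/2 \<and> x i r \<ge> 1/2)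
        \<or> (x i p \<ge> 1/2 \<and> x i r \<ge> 1/2) \<or> (x i p \<ge> 1/2 \<and> x i q \<ge> 1/2)"
      unfolding comp.mostly_low_def using B by (auto simp: insert_Diff_if)
    ultimately show ?thesis by linarith
  qed
  obtain a b c where A: "a \<in> A" "b \<in> A" "c \<in> A" "a \<noteq> b" "a \<noteq> c" "b \<noteq> c"
    using card_rows by (auto simp: card_3_iff)
  \<comment> \<open>By the pigeonhole principle, two of the three rows have the same majority.\<close>
  then show False
    using split[of a] split[of b] split[of c] mostly_low_row_unique[of a b]
      mostly_low_row_unique[of a c] mostly_low_row_unique[of b c] comp.mostly_low_row_unique[of a b]
      comp.mostly_low_row_unique[of a c] comp.mostly_low_row_unique[of b c] by argo
qed

section \<open>Defects of 2-colorings as contrasts\<close>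

lemma complete_digraph_arcs_iff:
  assumes "K\<^bsub>n\<^esub> (with_proj G)"
  shows "(u, v) \<in> parcs G \<longleftrightarrow> u \<in> pverts G \<and> v \<in> pverts G \<and> u \<noteq> v"
  using assms unfolding complete_digraph_pair_def by blast

lemma nbhd_product_of_complete:
  assumes "K\<^bsub>m\<^esub> (with_proj G)" "K\<^bsub>n\<^esub> (with_proj H)" "i \<in> pverts G" "p \<in> pverts H"
  shows "nbhd (G \<box> H) (i, p) =
    (\<lambda>j. (j, p)) ` (pverts G - {i}) \<union> Pair i ` (pverts H - {p})"
  using assms(3,4)
  by (auto simp: nbhd_def cartesian_product_def complete_digraph_arcs_iff[OF assms(1)]
      complete_digraph_arcs_iff[OF assms(2)])

lemma two_colors: "{Suc 0..2} = {Suc 0, 2}"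
  by auto

lemma sum_min_two_colors:
  assumes "coloring G 2 f" "v \<in> pverts G" "w \<in> pverts G"
  shows "(\<Sum>j=1..2. min (f v j) (f w j)) = 1 - \<bar>f v 1 - f w 1\<bar>"
proof -
  have "f v 1 + f v 2 = 1" "f w 1 + f w 2 = 1"
    using assms by (auto simp: coloring_def two_colors)
  then show ?thesis by (simp add: two_colors)
qed

lemma df_product_of_triangles:
  assumes G: "K\<^bsub>3\<^esub> (with_proj G)" and H: "K\<^bsub>3\<^esub> (with_proj H)" and f: "coloring (G \<box> H) 2 f"
    and i: "i \<in> pverts G" and p: "p \<in> pverts H"
  shows "df (G \<box> H) 2 f (i, p) =
    4 - ((\<Sum>j\<in>pverts G. \<bar>f (i, p) 1 - f (j, p) 1\<bar>) + (\<Sum>q\<in>pverts H. \<bar>f (i, p) 1 - f (i, q) 1\<bar>))"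
proof -
  have fin: "finite (pverts G)" "finite (pverts H)"
    and card: "card (pverts G - {i}) = 2" "card (pverts H - {p}) = 2"
    using G H i p by (auto simp: complete_digraph_pair_def)
  have verts: "pverts (G \<box> H) = pverts G \<times> pverts H"
    by (simp add: cartesian_product_def)
  have "df (G \<box> H) 2 f (i, p) = (\<Sum>w\<in>nbhd (G \<box> H) (i, p). 1 - \<bar>f (i, p) 1 - f w 1\<bar>)"
    unfolding df_def
    by (intro sum.cong refl sum_min_two_colors[OF f])
      (use i p in \<open>auto simp: verts nbhd_product_of_complete[OF G H i p]\<close>)
  also have "\<dots> = (\<Sum>w\<in>(\<lambda>j. (j, p)) ` (pverts G - {i}). 1 - \<bar>f (i, p) 1 - f w 1\<bar>)
      + (\<Sum>w\<in>Pair i ` (pverts H - {p}). 1 - \<bar>f (i, p) 1 - f w 1\<bar>)"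
    unfolding nbhd_product_of_complete[OF G H i p]
    by (rule sum.union_disjoint) (use fin in auto)
  also have "\<dots> = (\<Sum>j\<in>pverts G - {i}. 1 - \<bar>f (i, p) 1 - f (j, p) 1\<bar>)
      + (\<Sum>q\<in>pverts H - {p}. 1 - \<bar>f (i, p) 1 - f (i, q) 1\<bar>)"
    by (simp add: sum.reindex inj_on_def)
  also have "\<dots> = 4 - ((\<Sum>j\<in>pverts G. \<bar>f (i, p) 1 - f (j, p) 1\<bar>)
      + (\<Sum>q\<in>pverts H. \<bar>f (i, p) 1 - f (i, q) 1\<bar>))"
    by (simp add: sum_subtractf card sum.remove[OF fin(1) i] sum.remove[OF fin(2) p])
  finally show ?thesis .
qed

lemma defect_triangles_ge_2:
  assumes G: "K\<^bsub>3\<^esub> (with_proj G)" and H: "K\<^bsub>3\<^esub> (with_proj H)" and f: "coloring (G \<box> H) 2 f"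
  shows "2 \<le> defect (G \<box> H) 2 f"
proof (rule ccontr)
  assume less: "\<not> 2 \<le> defect (G \<box> H) 2 f"
  have fin: "finite (pverts G)" "finite (pverts H)"
    and card: "card (pverts G) = 3" "card (pverts H) = 3"
    using G H by (auto simp: complete_digraph_pair_def)
  have verts: "pverts (G \<box> H) = pverts G \<times> pverts H"
    by (simp add: cartesian_product_def)
  have "contrasting_grid (pverts G) (pverts H) (\<lambda>i p. f (i, p) 1)"
  proof
    fix i p assume ip: "i \<in> pverts G" "p \<in> pverts H"
      have "0 \<le> f (i, p) 1" "0 \<le> f (i, p) 2" "f (i, p) 1 + f (i, p) 2 = 1"
      using f ip by (auto simp: coloring_def verts two_colors)
    then show "0 \<le> f (i, p) 1 \<and> f (i, p) 1 \<le> 1" by simp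
    have "df (G \<box> H) 2 f (i, p) \<le> defect (G \<box> H) 2 f"
      unfolding defect_def using ip fin by (intro Max_ge) (auto simp: verts)
    with less df_product_of_triangles[OF G H f ip]
    show "2 < (\<Sum>j\<in>pverts G. \<bar>f (i, p) 1 - f (j, p) 1\<bar>)
        + (\<Sum>q\<in>pverts H. \<bar>f (i, p) 1 - f (i, q) 1\<bar>)" by simp
  qed (fact card)+
  then show False using no_contrasting_grid by blast
qed

text \<open>The witness uses color 1 on a diagonal and color 2 elsewhere. A diagonal cell differs from all its neighbors, any
  other cell differs from the diagonal cells of its row and of its column.\<close>

lemma diagonal_coloring_of_triangles:
  assumes G: "K\<^bsub>3\<^esub> (with_proj G)" and H: "K\<^bsub>3\<^esub> (with_proj H)"
  shows "\<exists>f. coloring (G \<box> H) 2 f \<and> defect (G \<box> H) 2 f \<le> 2"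
proof -
  obtain a b c where A: "pverts G = {a, b, c}" "a \<noteq> b" "a \<noteq> c" "b \<noteq> c"
    using G by (auto simp: complete_digraph_pair_def card_3_iff)
  obtain p q r where B: "pverts H = {p, q, r}" "p \<noteq> q" "p \<noteq> r" "q \<noteq> r"
    using H by (auto simp: complete_digraph_pair_def card_3_iff)
  have verts: "pverts (G \<box> H) = pverts G \<times> pverts H"
    by (simp add: cartesian_product_def)
  define f :: "'a \<times> 'b \<Rightarrow> nat \<Rightarrow> real" where
    "f v j = (if v \<in> {(a, p), (b, q), (c, r)} \<longleftrightarrow> j = 1 then 1 else 0)" for v j
  have f: "coloring (G \<box> H) 2 f"
    by (auto simp: coloring_def f_def two_colors)
  have "df (G \<box> H) 2 f (i, s) \<le> 2" if "i \<in> pverts G" "s \<in> pverts H" for i s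
    unfolding df_product_of_triangles[OF G H f that]
    using that A B by (auto simp: f_def)
  then have "defect (G \<box> H) 2 f \<le> 2"
    unfolding defect_def by (subst Max_le_iff) (auto simp: verts A B)
  with f show ?thesis by blast
qed

theorem lemma9:
  fixes G :: "'a pair_pre_digraph" and H :: "'b pair_pre_digraph"
  assumes "K\<^bsub>3\<^esub> (with_proj G)" and "K\<^bsub>3\<^esub> (with_proj H)"
  shows "minimum_defect (G \<box> H) 2 = 2"
proof -
  have "pair_graph (G \<box> H)"
    using assms by (intro pair_graph_cartesian_product pair_graphI_complete)
  moreover have "pverts (G \<box> H) \<noteq> {}"
    using assms by (auto simp: cartesian_product_def complete_digraph_pair_def)
  ultimately obtain f where f: "coloring (G \<box> H) 2 f"
      "defect (G \<box> H) 2 f = minimum_defect (G \<box> H) 2"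
    and least: "\<And>g. coloring (G \<box> H) 2 g \<Longrightarrow> minimum_defect (G \<box> H) 2 \<le> defect (G \<box> H) 2 g"
    using minimum_defect_attained[of "G \<box> H" 2] by auto
  have "2 \<le> minimum_defect (G \<box> H) 2"
    using defect_triangles_ge_2[OF assms f(1)] f(2) by simp
  moreover have "minimum_defect (G \<box> H) 2 \<le> 2"
    using diagonal_coloring_of_triangles[OF assms] least by force
  ultimately show ?thesis by simp
qed

end
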